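(* Let $H$ be a complex Hilbert space, let $A$ be a linear, closed, densely defined operator in $H$, let $a>0$ be a constant, and let $T=A^*A$, $T_a=T+aI$, $T_{ia}=T+iaI$. Then the operator $S_0=T_a^{-1}A^*$ with domain $D(A^* )$ is closable, and its closure $S$ is a bounded operator defined on all of $H$ with $$\|S\|\le \frac{1}{2\sqrt a}.$$ Similarly, the operator $T_{ia}^{-1}A^*$ with domain $D(A^* )$ is closable and its closure is a bounded operator defined on all of $H$.
   Context: $D(\cdot)$ denotes the domain of an operator; "an operator in $H$" means a linear map $D(A)\subset H\to H$, possibly unbounded. $T=A^*A$ is the nonnegative selfadjoint operator with $D(T)=\{u\in D(A): Au\in D(A^* )\}$, $I$ is the identity and $i$ is the imaginary unit. *)

theory Defs
  imports "HOL-Analysis.Analysis"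
begin

text \<open>
  The distribution has real inner product spaces only.  The classes below add a complex scalar
  multiplication and a complex inner product (linear in the first argument) on top of
  \<^class>\<open>real_normed_vector\<close>, whose norm, metric and topology they share.
  Positive definiteness is contained in \<open>cinner_self\<close>.
\<close>

class complex_inner = real_normed_vector +
  fixes scaleC :: "complex \<Rightarrow> 'a \<Rightarrow> 'a" (infixr "*\<^sub>C" 75)
    and cinner :: "'a \<Rightarrow> 'a \<Rightarrow> complex"
  assumes scaleC_add_right: "c *\<^sub>C (x + y) = c *\<^sub>C x + c *\<^sub>C y"
    and scaleC_add_left: "(c + d) *\<^sub>C x = c *\<^sub>C x + d *\<^sub>C x"
    and scaleC_scaleC: "c *\<^sub>C d *\<^sub>C x = (c * d) *\<^sub>C x"
    and scaleR_scaleC: "r *\<^sub>R x = complex_of_real r *\<^sub>C x"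
    and cinner_commute: "cinner x y = cnj (cinner y x)"
    and cinner_add_left: "cinner (x + y) z = cinner x z + cinner y z"
    and cinner_scaleC_left: "cinner (c *\<^sub>C x) y = c * cinner x y"
    and cinner_self: "cinner x x = complex_of_real ((norm x)\<^sup>2)"

class chilbert_space = complex_inner + complete_space

instantiation complex :: chilbert_space
begin

definition scaleC_complex :: "complex \<Rightarrow> complex \<Rightarrow> complex"
  where "scaleC_complex c x = c * x"

definition cinner_complex :: "complex \<Rightarrow> complex \<Rightarrow> complex"
  where "cinner_complex x y = x * cnj y"

instance
proof
  fix c d x y z :: complex and r :: real
  show "c *\<^sub>C (x + y) = c *\<^sub>C x + c *\<^sub>C y" "(c + d) *\<^sub>C x = c *\<^sub>C x + d *\<^sub>C x"
    "cinner (x + y) z = cinner x z + cinner y z"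
    unfolding scaleC_complex_def cinner_complex_def by (rule distrib_left distrib_right)+
  show "c *\<^sub>C d *\<^sub>C x = (c * d) *\<^sub>C x" "cinner (c *\<^sub>C x) y = c * cinner x y"
    unfolding scaleC_complex_def cinner_complex_def by (rule mult.assoc[symmetric] mult.assoc)+
  show "r *\<^sub>R x = complex_of_real r *\<^sub>C x"
    unfolding scaleC_complex_def by (rule scaleR_conv_of_real)
  show "cinner x y = cnj (cinner y x)"
    unfolding cinner_complex_def by simp
  show "cinner x x = complex_of_real ((norm x)\<^sup>2)"
    unfolding cinner_complex_def by (rule complex_norm_square[symmetric])
qed

end

text \<open>
  An operator in \<open>H\<close> is a partial map \<open>A :: 'a \<rightharpoonup> 'a\<close> whose domain \<open>D(A)\<close> is \<^term>\<open>dom A\<close>.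
  Products of operators, with their natural domain, are compositions \<open>\<circ>\<^sub>m\<close> of partial maps.
\<close>

definition linear_op :: "('a::complex_inner \<rightharpoonup> 'a) \<Rightarrow> bool" where
  "linear_op A \<longleftrightarrow> 0 \<in> dom A \<and>
     (\<forall>x y u v. A x = Some u \<longrightarrow> A y = Some v \<longrightarrow> A (x + y) = Some (u + v)) \<and>
     (\<forall>c x u. A x = Some u \<longrightarrow> A (c *\<^sub>C x) = Some (c *\<^sub>C u))"

definition closed_op :: "('a::complex_inner \<rightharpoonup> 'a) \<Rightarrow> bool" where
  "closed_op A \<longleftrightarrow> closed (Map.graph A)"

definition densely_defined :: "('a::complex_inner \<rightharpoonup> 'a) \<Rightarrow> bool" where
  "densely_defined A \<longleftrightarrow> closure (dom A) = UNIV"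

text \<open>Points with no value or more than one value are outside the domain of \<open>op_of_graph G\<close>.\<close>

definition op_of_graph :: "('a \<times> 'a) set \<Rightarrow> ('a \<rightharpoonup> 'a)" where
  "op_of_graph G x = (if \<exists>!y. (x, y) \<in> G then Some (THE y. (x, y) \<in> G) else None)"

text \<open>For densely defined \<open>A\<close> the vector \<open>w\<close> below is unique whenever it exists.\<close>

definition op_adjoint :: "('a::complex_inner \<rightharpoonup> 'a) \<Rightarrow> ('a \<rightharpoonup> 'a)" where
  "op_adjoint A = op_of_graph {(v, w). \<forall>u \<in> dom A. cinner (the (A u)) v = cinner u w}"

definition op_inverse :: "('a \<rightharpoonup> 'a) \<Rightarrow> ('a \<rightharpoonup> 'a)" where
  "op_inverse A = op_of_graph ((Map.graph A)\<inverse>)"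

definition op_plus_scalar :: "('a::complex_inner \<rightharpoonup> 'a) \<Rightarrow> complex \<Rightarrow> ('a \<rightharpoonup> 'a)" where
  "op_plus_scalar A z = (\<lambda>x. map_option (\<lambda>y. y + z *\<^sub>C x) (A x))"

definition closable_op :: "('a::complex_inner \<rightharpoonup> 'a) \<Rightarrow> bool" where
  "closable_op A \<longleftrightarrow> single_valued (closure (Map.graph A))"

definition op_closure :: "('a::complex_inner \<rightharpoonup> 'a) \<Rightarrow> ('a \<rightharpoonup> 'a)" where
  "op_closure A = op_of_graph (closure (Map.graph A))"

definition bounded_op :: "('a::complex_inner \<rightharpoonup> 'a) \<Rightarrow> bool" where
  "bounded_op A \<longleftrightarrow> linear_op A \<and> (\<exists>K. \<forall>x \<in> dom A. norm (the (A x)) \<le> K * norm x)"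

end

theory Submission
  imports Defs
begin

text \<open>
  For \<open>f \<in> H\<close> solve the weak form of \<open>T u + z u = A\<^sup>* f\<close>, that is
  \<open>z \<langle>u, x\<rangle> + \<langle>A u, A x\<rangle> = \<langle>f, A x\<rangle>\<close> for all \<open>x \<in> D(A)\<close>. It makes sense for every \<open>f\<close>, not only for
  \<open>f \<in> D(A\<^sup>*)\<close>, and has a unique solution \<open>Q f\<close> for every \<open>z\<close> outside \<open>(-\<infinity>, 0]\<close>. Testing with \<open>x = u\<close>
  and completing a square gives \<open>\<parallel>Q f\<parallel> \<le> sqrt \<bar>z\<bar> / \<bar>\<bar>z\<bar> + z\<bar> \<sqdot> \<parallel>f\<parallel>\<close>, which is \<open>\<parallel>f\<parallel> / (2 sqrt a)\<close> for
  \<open>z = a > 0\<close>. Since \<open>(T + z)\<^sup>-\<^sup>1 A\<^sup>*\<close> is the restriction of \<open>Q\<close> to the dense subspace \<open>D(A\<^sup>*)\<close>, its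
  closure is \<open>Q\<close>.
\<close>

section \<open>Elementary identities for complex scalars and inner products, up to
  Cauchy--Schwarz\<close>

lemma scaleC_one [simp]: "1 *\<^sub>C x = (x::'a::complex_inner)"
  using scaleR_scaleC[of 1 x] by simp

lemma scaleC_minus1: "(-1) *\<^sub>C x = - (x::'a::complex_inner)"
  using scaleR_scaleC[of "-1" x] by simp

lemma scaleC_zero_right [simp]: "c *\<^sub>C 0 = (0::'a::complex_inner)"
  using scaleC_add_right[of c 0 "0::'a"] by simp

lemma scaleC_zero_left [simp]: "0 *\<^sub>C x = (0::'a::complex_inner)"
  using scaleC_add_left[of 0 0 x] by simp

lemma scaleC_minus_right: "c *\<^sub>C (- x) = - (c *\<^sub>C (x::'a::complex_inner))"
  using scaleC_add_right[of c x "-x"] by (simp add: eq_neg_iff_add_eq_0 add.commute)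

lemma scaleC_diff_right: "c *\<^sub>C (x - y) = c *\<^sub>C x - c *\<^sub>C (y::'a::complex_inner)"
  using scaleC_add_right[of c x "-y"] by (simp add: scaleC_minus_right)

lemma scaleC_minus_left: "(- c) *\<^sub>C x = - (c *\<^sub>C (x::'a::complex_inner))"
  using scaleC_add_left[of c "-c" x] by (simp add: eq_neg_iff_add_eq_0 add.commute)

lemma scaleC_diff_left: "(c - d) *\<^sub>C x = c *\<^sub>C x - d *\<^sub>C (x::'a::complex_inner)"
  using scaleC_add_left[of c "-d" x] by (simp add: scaleC_minus_left)

lemma cinner_add_right: "cinner x (y + z) = cinner x y + cinner x (z::'a::complex_inner)"
  unfolding cinner_commute[of x "y + z"] cinner_add_left complex_cnj_add cinner_commute[symmetric] ..

lemma cinner_scaleC_right: "cinner x (c *\<^sub>C y) = cnj c * cinner x (y::'a::complex_inner)"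
  unfolding cinner_commute[of x "c *\<^sub>C y"] cinner_scaleC_left complex_cnj_mult cinner_commute[symmetric] ..

lemma cinner_zero_left [simp]: "cinner 0 (y::'a::complex_inner) = 0"
  using cinner_add_left[of 0 0 y] by simp

lemma cinner_zero_right [simp]: "cinner (y::'a::complex_inner) 0 = 0"
  using cinner_add_right[of y 0 0] by simp

lemma cinner_minus_left: "cinner (- x) (y::'a::complex_inner) = - cinner x y"
  using cinner_add_left[of x "-x" y] by (simp add: eq_neg_iff_add_eq_0 add.commute)

lemma cinner_minus_right: "cinner x (- y) = - cinner x (y::'a::complex_inner)"
  using cinner_add_right[of x y "-y"] by (simp add: eq_neg_iff_add_eq_0 add.commute)

lemma cinner_diff_left: "cinner (x - y) (z::'a::complex_inner) = cinner x z - cinner y z"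
  using cinner_add_left[of x "-y" z] by (simp add: cinner_minus_left)

lemma cinner_diff_right: "cinner z (x - y) = cinner z x - cinner z (y::'a::complex_inner)"
  using cinner_add_right[of z x "-y"] by (simp add: cinner_minus_right)

lemma cinner_scaleR_left: "cinner (r *\<^sub>R x) (y::'a::complex_inner) = of_real r * cinner x y"
  by (simp add: scaleR_scaleC cinner_scaleC_left)

lemma cinner_scaleR_right: "cinner x (r *\<^sub>R y) = of_real r * cinner x (y::'a::complex_inner)"
  by (simp add: scaleR_scaleC cinner_scaleC_right)

lemmas cinner_simps = cinner_add_left cinner_add_right cinner_diff_left cinner_diff_right
  cinner_minus_left cinner_minus_right cinner_scaleC_left cinner_scaleC_right

lemma norm_scaleC: "norm (c *\<^sub>C x) = cmod c * norm (x::'a::complex_inner)"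
proof -
  have "complex_of_real ((norm (c *\<^sub>C x))\<^sup>2) = c * cnj c * complex_of_real ((norm x)\<^sup>2)"
    by (simp only: cinner_self[symmetric] cinner_simps) (simp add: mult_ac)
  also have "\<dots> = complex_of_real ((cmod c * norm x)\<^sup>2)"
    by (simp add: complex_norm_square[symmetric] power_mult_distrib)
  finally have "(norm (c *\<^sub>C x))\<^sup>2 = (cmod c * norm x)\<^sup>2"
    using of_real_eq_iff by blast
  then show ?thesis by simp
qed

lemma norm_plus_square:
  "(norm (x + y))\<^sup>2 = (norm x)\<^sup>2 + (norm y)\<^sup>2 + 2 * Re (cinner x (y::'a::complex_inner))"
proof -
  have "complex_of_real ((norm (x + y))\<^sup>2)
      = of_real ((norm x)\<^sup>2) + of_real ((norm y)\<^sup>2) + (cinner x y + cnj (cinner x y))"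
    by (simp only: cinner_self[symmetric] cinner_simps cinner_commute[of y x, symmetric]) simp
  also have "\<dots> = of_real ((norm x)\<^sup>2 + (norm y)\<^sup>2 + 2 * Re (cinner x y))"
    by (simp add: complex_add_cnj)
  finally show ?thesis
    using of_real_eq_iff by blast
qed

text \<open>Pythagoras for the projection of \<open>x\<close> onto the line spanned by
  \<open>y\<close>. Nonnegativity of the left side is Cauchy--Schwarz; the exact decrease later
  turns minimality of a distance into orthogonality.\<close>

lemma norm_minus_proj_square:
  assumes "y \<noteq> (0::'a::complex_inner)"
  shows "(norm (x - (cinner x y / of_real ((norm y)\<^sup>2)) *\<^sub>C y))\<^sup>2
    = (norm x)\<^sup>2 - (cmod (cinner x y))\<^sup>2 / (norm y)\<^sup>2"
proof -
  define b where "b = cinner x y"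
  define n where "n = (norm y)\<^sup>2"
  have n: "n > 0" using assms by (simp add: n_def)
  have "(norm (x + (- b / of_real n) *\<^sub>C y))\<^sup>2
      = (norm x)\<^sup>2 + (cmod b / n)\<^sup>2 * n + 2 * Re (- (cnj b * b) / of_real n)"
    unfolding norm_plus_square norm_scaleC cinner_simps b_def[symmetric] power_mult_distrib
      n_def[symmetric]
    using n by (simp add: norm_divide)
  also have "- (cnj b * b) / of_real n = of_real (- ((cmod b)\<^sup>2) / n)"
    by (simp only: mult.commute[of "cnj b"] complex_norm_square[symmetric] of_real_divide of_real_minus)
  finally have "(norm (x - (b / of_real n) *\<^sub>C y))\<^sup>2
      = (norm x)\<^sup>2 + (cmod b / n)\<^sup>2 * n + 2 * (- ((cmod b)\<^sup>2) / n)"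
    by (simp add: scaleC_minus_left)
  also have "\<dots> = (norm x)\<^sup>2 - (cmod b)\<^sup>2 / n"
    using n by (simp add: power2_eq_square field_simps)
  finally show ?thesis
    unfolding b_def n_def .
qed

lemma norm_cinner_le: "cmod (cinner x y) \<le> norm x * norm (y::'a::complex_inner)"
proof (cases "y = 0")
  case False
  have "0 \<le> (norm x)\<^sup>2 - (cmod (cinner x y))\<^sup>2 / (norm y)\<^sup>2"
    unfolding norm_minus_proj_square[OF False, symmetric] by simp
  then have "(cmod (cinner x y))\<^sup>2 \<le> (norm x * norm y)\<^sup>2"
    using False by (simp add: field_simps)
  then show ?thesis by (rule power2_le_imp_le) simp
qed simp

text \<open>The existing product norm is the Euclidean one, so it comes from the sum of the two
  inner products. This makes projections available on the graph of an operator.\<close>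

instantiation prod :: (complex_inner, complex_inner) complex_inner
begin

definition scaleC_prod :: "complex \<Rightarrow> 'a \<times> 'b \<Rightarrow> 'a \<times> 'b"
  where "scaleC_prod c x = (c *\<^sub>C fst x, c *\<^sub>C snd x)"

definition cinner_prod :: "'a \<times> 'b \<Rightarrow> 'a \<times> 'b \<Rightarrow> complex"
  where "cinner_prod x y = cinner (fst x) (fst y) + cinner (snd x) (snd y)"

instance
proof
  fix c d :: complex and x y z :: "'a \<times> 'b" and r :: real
  show "c *\<^sub>C (x + y) = c *\<^sub>C x + c *\<^sub>C y" "(c + d) *\<^sub>C x = c *\<^sub>C x + d *\<^sub>C x"
    "c *\<^sub>C d *\<^sub>C x = (c * d) *\<^sub>C x"
    by (simp_all add: scaleC_prod_def scaleC_add_right scaleC_add_left scaleC_scaleC)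
  show "r *\<^sub>R x = complex_of_real r *\<^sub>C x"
    by (simp add: scaleC_prod_def scaleR_scaleC[symmetric] prod_eq_iff)
  show "cinner x y = cnj (cinner y x)"
    by (simp add: cinner_prod_def cinner_commute[symmetric])
  show "cinner (x + y) z = cinner x z + cinner y z" "cinner (c *\<^sub>C x) y = c * cinner x y"
    by (simp_all add: cinner_prod_def scaleC_prod_def cinner_simps algebra_simps)
  show "cinner x x = complex_of_real ((norm x)\<^sup>2)"
    by (simp add: cinner_prod_def norm_prod_def cinner_self)
qed

end

section \<open>Complete subspaces: orthogonal projection, density and Lax--Milgram\<close>

definition csubspace :: "'a::complex_inner set \<Rightarrow> bool" where
  "csubspace M \<longleftrightarrow> 0 \<in> M \<and> (\<forall>x\<in>M. \<forall>y\<in>M. x + y \<in> M) \<and> (\<forall>c. \<forall>x\<in>M. c *\<^sub>C x \<in> M)"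

lemma csubspace_diff:
  assumes "csubspace M" "x \<in> M" "y \<in> M"
  shows "x - y \<in> M"
proof -
  have "x + (-1) *\<^sub>C y \<in> M" using assms by (simp add: csubspace_def)
  then show ?thesis by (simp add: scaleC_minus1)
qed

lemma tendsto_scaleC:
  fixes f :: "'b \<Rightarrow> 'a::complex_inner"
  assumes "(f \<longlongrightarrow> l) F"
  shows "((\<lambda>x. c *\<^sub>C f x) \<longlongrightarrow> c *\<^sub>C l) F"
proof (rule metric_tendsto_imp_tendsto[where f = "\<lambda>x. cmod c *\<^sub>R f x" and a = "cmod c *\<^sub>R l"])
  show "((\<lambda>x. cmod c *\<^sub>R f x) \<longlongrightarrow> cmod c *\<^sub>R l) F"
    by (intro tendsto_intros assms)
  show "\<forall>\<^sub>F x in F. dist (c *\<^sub>C f x) (c *\<^sub>C l) \<le> dist (cmod c *\<^sub>R f x) (cmod c *\<^sub>R l)"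
    by (simp add: dist_norm scaleC_diff_right[symmetric] scaleR_diff_right[symmetric] norm_scaleC)
qed

lemma csubspace_closure:
  assumes "csubspace M"
  shows "csubspace (closure M)"
  unfolding csubspace_def
proof (intro conjI ballI allI)
  show "0 \<in> closure M"
    using assms closure_subset by (auto simp: csubspace_def)
next
  fix x y assume "x \<in> closure M" "y \<in> closure M"
  then obtain f g where "\<forall>n. f n \<in> M" "f \<longlonglongrightarrow> x" "\<forall>n. g n \<in> M" "g \<longlonglongrightarrow> y"
    by (auto simp: closure_sequential)
  then show "x + y \<in> closure M"
    using assms tendsto_add[of f x sequentially g y] unfolding closure_sequential csubspace_def
    by (intro exI[of _ "\<lambda>n. f n + g n"]) auto
next
  fix c x assume "x \<in> closure M"
  then obtain f where "\<forall>n. f n \<in> M" "f \<longlonglongrightarrow> x"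
    by (auto simp: closure_sequential)
  then show "c *\<^sub>C x \<in> closure M"
    using assms tendsto_scaleC[of f x sequentially c] unfolding closure_sequential csubspace_def
    by (intro exI[of _ "\<lambda>n. c *\<^sub>C f n"]) auto
qed

text \<open>The parallelogram law for \<open>k - x\<close> and \<open>k - y\<close>, whose sum is
  twice the vector from the midpoint of \<open>x\<close> and \<open>y\<close> to \<open>k\<close>.
  It forces nearly closest points to \<open>k\<close> to lie near each other.\<close>

lemma parallelogram_midpoint:
  fixes x y k :: "'a::complex_inner"
  shows "(norm (x - y))\<^sup>2 + 4 * (norm (k - (1/2) *\<^sub>C (x + y)))\<^sup>2
    = 2 * (norm (k - x))\<^sup>2 + 2 * (norm (k - y))\<^sup>2"
proof -
  let ?p = "k - x" and ?q = "k - y"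
  have "2 *\<^sub>C (k - (1/2) *\<^sub>C (x + y)) = 2 *\<^sub>C k - (x + y)"
    by (simp add: scaleC_diff_right scaleC_scaleC)
  also have "2 *\<^sub>C k = k + k"
    using scaleC_add_left[of 1 1 k] by simp
  finally have "2 *\<^sub>C (k - (1/2) *\<^sub>C (x + y)) = ?p + ?q"
    by (simp add: algebra_simps)
  then have "norm (?p + ?q) = 2 * norm (k - (1/2) *\<^sub>C (x + y))"
    using norm_scaleC[of 2 "k - (1/2) *\<^sub>C (x + y)"] by simp
  then have "4 * (norm (k - (1/2) *\<^sub>C (x + y)))\<^sup>2 = (norm (?p + ?q))\<^sup>2"
    by (simp add: power_mult_distrib)
  moreover have "(norm (x - y))\<^sup>2 = (norm (?p + - ?q))\<^sup>2"
    using norm_minus_commute[of x y] by simp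
  ultimately show ?thesis
    unfolding norm_plus_square by (simp only: norm_minus_cancel cinner_minus_right uminus_complex.sel)
qed

lemma orthogonal_projection_exists:
  fixes M :: "'a::complex_inner set"
  assumes "csubspace M" "complete M"
  shows "\<exists>m\<in>M. \<forall>x\<in>M. cinner (k - m) x = 0"
proof -
  define d where "d = (INF x\<in>M. (norm (k - x))\<^sup>2)"
  have M0: "0 \<in> M" and Madd: "\<And>x y. x \<in> M \<Longrightarrow> y \<in> M \<Longrightarrow> x + y \<in> M"
    and Msc: "\<And>c x. x \<in> M \<Longrightarrow> c *\<^sub>C x \<in> M"
    using assms(1) by (auto simp: csubspace_def)
  have bdd: "bdd_below ((\<lambda>x. (norm (k - x))\<^sup>2) ` M)"
    by (rule bdd_belowI[of _ 0]) auto
  have low: "d \<le> (norm (k - x))\<^sup>2" if "x \<in> M" for x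
    unfolding d_def by (rule cINF_lower[OF bdd that])
  have "\<exists>x\<in>M. (norm (k - x))\<^sup>2 < d + inverse (real (Suc n))" for n
    using cINF_less_iff[OF _ bdd, of "d + inverse (real (Suc n))"] M0 unfolding d_def[symmetric]
    by auto
  then obtain f where fM: "\<And>n. f n \<in> M"
    and f: "\<And>n. (norm (k - f n))\<^sup>2 < d + inverse (real (Suc n))"
    by metis
  \<comment> \<open>The midpoint of \<open>f i\<close> and \<open>f j\<close> lies in
    \<open>M\<close>, so its squared distance to \<open>k\<close> is at least \<open>d\<close>; the
    two contributions \<open>4 * d\<close> cancel.\<close>
  have dist_f: "(norm (f i - f j))\<^sup>2 \<le> 2 * inverse (real (Suc i)) + 2 * inverse (real (Suc j))"
    for i j
    using parallelogram_midpoint[of "f i" "f j" k] f[of i] f[of j]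
      low[OF Msc[OF Madd[OF fM[of i] fM[of j]], of "1/2"]] by linarith
  have "Cauchy f"
  proof (rule metric_CauchyI)
    fix e :: real assume e: "e > 0"
    then obtain N where N: "inverse (real (Suc N)) < e\<^sup>2 / 4"
      using reals_Archimedean[of "e\<^sup>2 / 4"] by auto
    show "\<exists>N. \<forall>i\<ge>N. \<forall>j\<ge>N. dist (f i) (f j) < e"
    proof (intro exI allI impI)
      fix i j assume "i \<ge> N" "j \<ge> N"
      then have "inverse (real (Suc i)) \<le> inverse (real (Suc N))"
        "inverse (real (Suc j)) \<le> inverse (real (Suc N))"
        by (auto intro!: le_imp_inverse_le)
      then have "(norm (f i - f j))\<^sup>2 < e\<^sup>2"
        using dist_f[of i j] N by linarith
      then show "dist (f i) (f j) < e"
        unfolding dist_norm using e by (auto intro: power2_less_imp_less)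
    qed
  qed
  then obtain m where m: "m \<in> M" "f \<longlonglongrightarrow> m"
    using assms(2) fM unfolding complete_def by metis
  have "(norm (k - m))\<^sup>2 \<le> d + 0"
  proof (rule LIMSEQ_le)
    show "(\<lambda>n. (norm (k - f n))\<^sup>2) \<longlonglongrightarrow> (norm (k - m))\<^sup>2"
      by (intro tendsto_intros m)
    show "(\<lambda>n. d + inverse (real (Suc n))) \<longlonglongrightarrow> d + 0"
      by (intro tendsto_intros LIMSEQ_inverse_real_of_nat)
    show "\<exists>N. \<forall>n\<ge>N. (norm (k - f n))\<^sup>2 \<le> d + inverse (real (Suc n))"
      using f by (auto intro: less_imp_le)
  qed
  then have min: "(norm (k - m))\<^sup>2 \<le> (norm (k - x))\<^sup>2" if "x \<in> M" for x
    using low[OF that] by linarith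
  have "cinner (k - m) x = 0" if x: "x \<in> M" for x
  \<comment> \<open>A nonzero inner product would let a move from \<open>m\<close> along
    \<open>x\<close> get strictly closer to \<open>k\<close>.\<close>
  proof (cases "x = 0")
    case False
    let ?c = "cinner (k - m) x / of_real ((norm x)\<^sup>2)"
    have "(norm (k - m))\<^sup>2 \<le> (norm (k - m - ?c *\<^sub>C x))\<^sup>2"
      using min[OF Madd[OF m(1) Msc[OF x, of ?c]]] by (simp add: algebra_simps)
    then have "(cmod (cinner (k - m) x))\<^sup>2 / (norm x)\<^sup>2 \<le> 0"
      unfolding norm_minus_proj_square[OF False] by simp
    then show ?thesis using False by (simp add: divide_le_0_iff)
  qed simp
  with m(1) show ?thesis by blast
qed

text \<open>Pythagoras for \<open>k = (k - m) + m\<close>. Applied to differences of projected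
  points it shows that projection does not increase distances.\<close>

lemma norm_le_of_orthogonal_diff:
  fixes k m :: "'a::complex_inner"
  assumes "cinner (k - m) m = 0"
  shows "norm m \<le> norm k"
proof -
  have "(norm k)\<^sup>2 = (norm (k - m))\<^sup>2 + (norm m)\<^sup>2"
    using norm_plus_square[of "k - m" m] assms by simp
  then have "(norm m)\<^sup>2 \<le> (norm k)\<^sup>2" by simp
  then show ?thesis by (rule power2_le_imp_le) simp
qed

text \<open>The residual of projecting any \<open>k\<close> onto \<open>closure M\<close> is
  orthogonal to \<open>M\<close>, hence zero.\<close>

lemma dense_of_trivial_orthogonal:
  fixes M :: "'a::chilbert_space set"
  assumes "csubspace M" and orth: "\<And>y. (\<And>x. x \<in> M \<Longrightarrow> cinner y x = 0) \<Longrightarrow> y = 0"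
  shows "closure M = UNIV"
proof -
  have "k \<in> closure M" for k
  proof -
    have "complete (closure M)" by (simp add: complete_eq_closed)
    then obtain m where m: "m \<in> closure M" "\<And>x. x \<in> closure M \<Longrightarrow> cinner (k - m) x = 0"
      using orthogonal_projection_exists[OF csubspace_closure[OF assms(1)]] by blast
    then have "k - m = 0"
      using closure_subset[of M] by (intro orth) auto
    with m show ?thesis by simp
  qed
  then show ?thesis by auto
qed

text \<open>
  Lax--Milgram: the solution is the fixed point of the contraction
  \<open>m \<mapsto> P (m - \<rho> (D m - k))\<close>, with \<open>P\<close> the orthogonal projection onto \<open>M\<close>.
\<close>

lemma lax_milgram:
  fixes M :: "'a::complex_inner set" and D :: "'a \<Rightarrow> 'a"
  assumes M: "csubspace M" "complete M"
    and D: "\<And>x y. D (x - y) = D x - D y"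
    and c: "c < 1" "\<And>x. norm (x - \<rho> *\<^sub>C D x) \<le> c * norm x"
    and "\<rho> \<noteq> 0"
  shows "\<exists>m\<in>M. \<forall>x\<in>M. cinner (D m - k) x = 0"
proof -
  define P where "P y = (SOME m. m \<in> M \<and> (\<forall>x\<in>M. cinner (y - m) x = 0))" for y
  have P: "P y \<in> M" "\<And>x. x \<in> M \<Longrightarrow> cinner (y - P y) x = 0" for y
    using someI_ex[OF orthogonal_projection_exists[OF M, of y, unfolded Bex_def]]
    unfolding P_def[symmetric] by auto
  define \<Phi> where "\<Phi> m = P (m - \<rho> *\<^sub>C (D m - k))" for m
  have P_contr: "norm (P y - P y') \<le> norm (y - y')" for y y'
  proof (rule norm_le_of_orthogonal_diff)
    have "P y - P y' \<in> M" by (intro csubspace_diff M P)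
    then have "cinner (y - P y) (P y - P y') - cinner (y' - P y') (P y - P y') = 0"
      using P by simp
    then show "cinner (y - y' - (P y - P y')) (P y - P y') = 0"
      unfolding cinner_diff_left[symmetric] by (simp add: algebra_simps)
  qed
  \<comment> \<open>The constant \<open>c\<close> can be negative when the space is trivial, while
    \<open>Banach_fix\<close> asks for a nonnegative one; hence \<open>max c 0\<close>.\<close>
  have contr: "dist (\<Phi> x) (\<Phi> y) \<le> max c 0 * dist x y" for x y
  proof -
    have "norm (\<Phi> x - \<Phi> y) \<le> norm ((x - \<rho> *\<^sub>C (D x - k)) - (y - \<rho> *\<^sub>C (D y - k)))"
      unfolding \<Phi>_def by (rule P_contr)
    also have "\<dots> = norm ((x - y) - \<rho> *\<^sub>C D (x - y))"
      by (simp add: D scaleC_diff_right algebra_simps)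
    also have "\<dots> \<le> c * norm (x - y)" by (rule c)
    also have "\<dots> \<le> max c 0 * norm (x - y)" by (intro mult_right_mono) auto
    finally show ?thesis by (simp add: dist_norm)
  qed
  have "\<exists>!x\<in>M. \<Phi> x = x"
  proof (rule Banach_fix[where c = "max c 0"])
    show "M \<noteq> {}" using M(1) by (auto simp: csubspace_def)
  qed (use M(2) c(1) contr P(1) in \<open>auto simp: \<Phi>_def\<close>)
  then obtain m where m: "m \<in> M" "\<Phi> m = m" by auto
  \<comment> \<open>At the fixed point the projection residual is
    \<open>- (\<rho> *\<^sub>C (D m - k))\<close>, and the factor \<open>\<rho>\<close> can be
    divided out.\<close>
  have "cinner (D m - k) x = 0" if "x \<in> M" for x
    using P(2)[OF that, of "m - \<rho> *\<^sub>C (D m - k)"] m(2) \<open>\<rho> \<noteq> 0\<close>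
    unfolding \<Phi>_def by (simp add: cinner_simps)
  with m(1) show ?thesis by blast
qed

text \<open>If \<open>f n\<close> in \<open>D\<close> tends to \<open>d\<close>, orthogonality gives
  \<open>cinner d d = cinner d (d - f n)\<close>, so Cauchy--Schwarz bounds \<open>norm d\<close> by
  a null sequence.\<close>

lemma orthogonal_to_dense_eq_0:
  fixes d :: "'a::complex_inner"
  assumes "closure D = UNIV" "\<And>u. u \<in> D \<Longrightarrow> cinner d u = 0"
  shows "d = 0"
proof -
  have "d \<in> closure D" by (simp add: assms(1))
  then obtain f where f: "\<And>n. f n \<in> D" "f \<longlonglongrightarrow> d"
    by (auto simp: closure_sequential)
  have "norm d \<le> norm (d - f n)" for n
  proof (cases "d = 0")
    case False
    have "norm d * norm d = cmod (cinner d (d - f n))"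
      using assms(2)[OF f(1)] by (simp add: cinner_diff_right cinner_self norm_power power2_eq_square norm_mult)
    also have "\<dots> \<le> norm d * norm (d - f n)" by (rule norm_cinner_le)
    finally show ?thesis using False by simp
  qed simp
  moreover have "(\<lambda>n. norm (d - f n)) \<longlonglongrightarrow> norm (d - d)"
    by (intro tendsto_intros f)
  ultimately have "norm d \<le> norm (d - d)"
    by (intro LIMSEQ_le_const) auto
  then show ?thesis by simp
qed

section \<open>Operators given by their graphs\<close>

lemma op_of_graph_eq_Some:
  assumes "single_valued G"
  shows "op_of_graph G x = Some y \<longleftrightarrow> (x, y) \<in> G"
proof
  assume xy: "(x, y) \<in> G"
  with assms have ex1: "\<exists>!y. (x, y) \<in> G" unfolding single_valued_def by blast
  then have "(THE y. (x, y) \<in> G) = y" using xy by (rule the1_equality)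
  with ex1 show "op_of_graph G x = Some y" unfolding op_of_graph_def by simp
next
  assume "op_of_graph G x = Some y"
  then have "\<exists>!y. (x, y) \<in> G" "y = (THE y. (x, y) \<in> G)"
    unfolding op_of_graph_def by (auto split: if_splits)
  then show "(x, y) \<in> G" using theI'[of "\<lambda>y. (x, y) \<in> G"] by simp
qed

text \<open>The graph of a continuous map is closed, which gives one inclusion; approximating
  \<open>x\<close> from \<open>D\<close> and applying continuity gives the other.\<close>

lemma closure_graph_restrict:
  fixes Q :: "'a::metric_space \<Rightarrow> 'b::metric_space"
  assumes "continuous_on UNIV Q" "closure D = UNIV"
  shows "closure (Map.graph (\<lambda>x. if x \<in> D then Some (Q x) else None)) = {(x, Q x) | x. True}"
    (is "closure ?G = ?H")
proof
  have "?H = {m. Q (fst m) = snd m}" by auto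
  moreover have "closed {m. Q (fst m) = snd m}"
    by (intro closed_Collect_eq continuous_on_compose2[OF assms(1)] continuous_intros) auto
  ultimately show "closure ?G \<subseteq> ?H"
    by (intro closure_minimal) (auto simp: Map.graph_def split: if_splits)
  show "?H \<subseteq> closure ?G"
  proof
    fix m assume "m \<in> ?H"
    then obtain x where m: "m = (x, Q x)" by auto
    have "x \<in> closure D" by (simp add: assms(2))
    then obtain f where f: "\<forall>n. f n \<in> D" "f \<longlonglongrightarrow> x"
      by (auto simp: closure_sequential)
    have "(\<lambda>n. Q (f n)) \<longlonglongrightarrow> Q x"
      using assms(1) f(2) by (auto intro: continuous_on_tendsto_compose)
    then have "(\<lambda>n. (f n, Q (f n))) \<longlonglongrightarrow> m"
      unfolding m by (intro tendsto_Pair f)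
    moreover have "\<forall>n. (f n, Q (f n)) \<in> ?G"
      using f(1) by (auto simp: Map.graph_def)
    ultimately show "m \<in> closure ?G"
      unfolding closure_sequential by (intro exI[of _ "\<lambda>n. (f n, Q (f n))"] conjI)
  qed
qed

section \<open>A closed densely defined operator and its adjoint\<close>

locale closed_dense_op =
  fixes A :: "'a::chilbert_space \<rightharpoonup> 'a"
  assumes linear: "linear_op A" and closed: "closed_op A" and dense: "densely_defined A"
begin

abbreviation app :: "'a \<Rightarrow> 'a" where "app x \<equiv> the (A x)"

lemma zero_in_dom [simp]: "0 \<in> dom A"
  using linear by (simp add: linear_op_def)

lemma op_add: "A x = Some u \<Longrightarrow> A y = Some v \<Longrightarrow> A (x + y) = Some (u + v)"
  and op_scaleC: "A x = Some u \<Longrightarrow> A (c *\<^sub>C x) = Some (c *\<^sub>C u)"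
  using linear unfolding linear_op_def by blast+

lemma dom_add: "x \<in> dom A \<Longrightarrow> y \<in> dom A \<Longrightarrow> x + y \<in> dom A"
  and app_add: "x \<in> dom A \<Longrightarrow> y \<in> dom A \<Longrightarrow> app (x + y) = app x + app y"
  by (auto simp: op_add)

lemma dom_scaleC: "x \<in> dom A \<Longrightarrow> c *\<^sub>C x \<in> dom A"
  and app_scaleC: "x \<in> dom A \<Longrightarrow> app (c *\<^sub>C x) = c *\<^sub>C app x"
  by (auto simp: op_scaleC)

lemma dom_diff: "x \<in> dom A \<Longrightarrow> y \<in> dom A \<Longrightarrow> x - y \<in> dom A"
  and app_diff: "x \<in> dom A \<Longrightarrow> y \<in> dom A \<Longrightarrow> app (x - y) = app x - app y"
  using dom_add[of x "(-1) *\<^sub>C y"] app_add[of x "(-1) *\<^sub>C y"] dom_scaleC[of y "-1"] app_scaleC[of y "-1"]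
  by (simp_all add: scaleC_minus1)

lemma app_zero [simp]: "app 0 = 0"
  using app_scaleC[of 0 0] by simp

text \<open>Two candidates for the adjoint value differ by a vector orthogonal to the dense set
  \<open>dom A\<close>, so the defining relation is single valued. Conjugation swaps the arguments
  of the inner product.\<close>

lemma adjoint_eq_Some:
  "op_adjoint A v = Some w \<longleftrightarrow> (\<forall>x\<in>dom A. cinner v (app x) = cinner w x)"
proof -
  let ?G = "{(v, w). \<forall>u\<in>dom A. cinner (app u) v = cinner u w}"
  have flip: "cinner (app u) v = cinner u w \<longleftrightarrow> cinner v (app u) = cinner w u" for u v w
    by (metis cinner_commute)
  have "single_valued ?G"
  proof (rule single_valuedI)
    fix v w w'
    assume "(v, w) \<in> ?G" "(v, w') \<in> ?G"
    then have "\<forall>u\<in>dom A. cinner w u = cinner w' u"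
      unfolding flip mem_Collect_eq split_conv by metis
    then have "w - w' = 0"
      using dense by (intro orthogonal_to_dense_eq_0[of "dom A"])
        (auto simp: densely_defined_def cinner_diff_left)
    then show "w = w'" by simp
  qed
  from op_of_graph_eq_Some[OF this] show ?thesis
    unfolding op_adjoint_def by (simp add: flip)
qed

lemma adjoint_diff:
  "op_adjoint A v = Some w \<Longrightarrow> op_adjoint A v' = Some w' \<Longrightarrow> op_adjoint A (v - v') = Some (w - w')"
  by (auto simp: adjoint_eq_Some cinner_diff_left)

lemma csubspace_dom_adjoint: "csubspace (dom (op_adjoint A))"
proof -
  have "op_adjoint A 0 = Some 0"
    by (simp add: adjoint_eq_Some)
  moreover have "op_adjoint A (v + v') = Some (w + w')"
    if "op_adjoint A v = Some w" "op_adjoint A v' = Some w'" for v v' w w'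
    using that by (simp add: adjoint_eq_Some cinner_add_left)
  moreover have "op_adjoint A (c *\<^sub>C v) = Some (c *\<^sub>C w)" if "op_adjoint A v = Some w" for c v w
    using that by (simp add: adjoint_eq_Some cinner_scaleC_left)
  ultimately show ?thesis
    unfolding csubspace_def by (auto simp: dom_def)
qed

section \<open>Weak solutions: linearity, existence, norm bound and uniqueness\<close>

text \<open>Formally \<open>T u + z u = p + A\<^sup>* q\<close>, with no demand that
  \<open>q\<close> lie in the domain of the adjoint. Two data serve both the resolvent
  (\<open>q = 0\<close>) and the extension of the composed operator (\<open>p = 0\<close>).\<close>

definition weak_solution :: "complex \<Rightarrow> 'a \<Rightarrow> 'a \<Rightarrow> 'a \<Rightarrow> bool" where
  "weak_solution z p q u \<longleftrightarrow> u \<in> dom A \<and>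
     (\<forall>x\<in>dom A. z * cinner u x + cinner (app u) (app x) = cinner p x + cinner q (app x))"

text \<open>Collecting the terms paired with \<open>app x\<close> leaves the defining relation of
  the adjoint at \<open>q - app u\<close>. Only this difference has to lie in its domain.\<close>

lemma weak_solution_iff_adjoint:
  "weak_solution z p q u \<longleftrightarrow> u \<in> dom A \<and> op_adjoint A (q - app u) = Some (z *\<^sub>C u - p)"
proof -
  have "z * cinner u x + cinner (app u) (app x) = cinner p x + cinner q (app x)
      \<longleftrightarrow> cinner (q - app u) (app x) = cinner (z *\<^sub>C u - p) x" for x
    by (auto simp: cinner_simps algebra_simps)
  then show ?thesis
    unfolding weak_solution_def adjoint_eq_Some by simp
qed

lemma weak_solution_diff:
  assumes "weak_solution z p q u" "weak_solution z p' q' u'"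
  shows "weak_solution z (p - p') (q - q') (u - u')"
  unfolding weak_solution_def
proof (intro conjI ballI)
  have dom: "u \<in> dom A" "u' \<in> dom A" using assms by (auto simp: weak_solution_def)
  then show "u - u' \<in> dom A" by (rule dom_diff)
  fix x assume "x \<in> dom A"
  then have "z * cinner u x + cinner (app u) (app x) = cinner p x + cinner q (app x)"
    "z * cinner u' x + cinner (app u') (app x) = cinner p' x + cinner q' (app x)"
    using assms by (simp_all add: weak_solution_def)
  then show "z * cinner (u - u') x + cinner (app (u - u')) (app x)
      = cinner (p - p') x + cinner (q - q') (app x)"
    unfolding app_diff[OF dom] cinner_diff_left by algebra
qed

lemma weak_solution_add:
  assumes "weak_solution z p q u" "weak_solution z p' q' u'"
  shows "weak_solution z (p + p') (q + q') (u + u')"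
  unfolding weak_solution_def
proof (intro conjI ballI)
  have dom: "u \<in> dom A" "u' \<in> dom A" using assms by (auto simp: weak_solution_def)
  then show "u + u' \<in> dom A" by (rule dom_add)
  fix x assume "x \<in> dom A"
  then have "z * cinner u x + cinner (app u) (app x) = cinner p x + cinner q (app x)"
    "z * cinner u' x + cinner (app u') (app x) = cinner p' x + cinner q' (app x)"
    using assms by (simp_all add: weak_solution_def)
  then show "z * cinner (u + u') x + cinner (app (u + u')) (app x)
      = cinner (p + p') x + cinner (q + q') (app x)"
    unfolding app_add[OF dom] cinner_add_left by algebra
qed

lemma weak_solution_scaleC:
  assumes "weak_solution z p q u"
  shows "weak_solution z (c *\<^sub>C p) (c *\<^sub>C q) (c *\<^sub>C u)"
  unfolding weak_solution_def
proof (intro conjI ballI)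
  show "c *\<^sub>C u \<in> dom A"
    using assms dom_scaleC by (simp add: weak_solution_def)
  fix x assume "x \<in> dom A"
  then have "c * (z * cinner u x + cinner (app u) (app x)) = c * (cinner p x + cinner q (app x))"
    and "app (c *\<^sub>C u) = c *\<^sub>C app u"
    using assms app_scaleC by (auto simp: weak_solution_def)
  then show "z * cinner (c *\<^sub>C u) x + cinner (app (c *\<^sub>C u)) (app x)
      = cinner (c *\<^sub>C p) x + cinner (c *\<^sub>C q) (app x)"
    by (simp add: cinner_scaleC_left algebra_simps)
qed

text \<open>
  Solved by Lax--Milgram on the graph of \<open>A\<close>, rescaled to \<open>M = {(s x, A x)}\<close> with \<open>s\<^sup>2 = \<bar>z\<bar>\<close>.
  With \<open>z = \<bar>z\<bar> \<zeta>\<close> the choice \<open>\<rho> = (1 + cnj \<zeta>) / 2\<close> gives \<open>1 - \<rho> \<zeta>\<close> and \<open>1 - \<rho>\<close> the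
  same modulus \<open>\<bar>1 - \<zeta>\<bar> / 2 < 1\<close>.
\<close>

lemma weak_solution_exists:
  assumes z: "complex_of_real (cmod z) + z \<noteq> 0"
  shows "\<exists>u. weak_solution z p q u"
proof -
  have z0: "z \<noteq> 0" using z by auto
  define s where "s = sqrt (cmod z)"
  have s: "s > 0" "s * s = cmod z" using z0 by (auto simp: s_def)
  define \<zeta> where "\<zeta> = z / of_real (cmod z)"
  have \<zeta>: "of_real (s * s) * \<zeta> = z" "cmod \<zeta> = 1" using z0 s by (auto simp: \<zeta>_def norm_divide)
  \<comment> \<open>The hypothesis on \<open>z\<close> says that \<open>z\<close> is off the half
    line of nonpositive reals, that is, its direction \<open>\<zeta>\<close> is not -1.\<close>
  have \<zeta>1: "1 + \<zeta> \<noteq> 0"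
    using z z0 by (auto simp: \<zeta>_def field_simps)
  define \<rho> where "\<rho> = (1 + cnj \<zeta>) / 2"
  define c where "c = cmod (1 - \<zeta>) / 2"
  have \<rho>: "1 - \<rho> * \<zeta> = (1 - \<zeta>) / 2" "1 - \<rho> = cnj (1 - \<zeta>) / 2"
    using complex_norm_square[of \<zeta>] \<zeta>(2) by (auto simp: \<rho>_def field_simps)
  have mod: "cmod (1 - \<rho> * \<zeta>) = c" "cmod (1 - \<rho>) = c"
    unfolding \<rho> c_def by (simp_all add: norm_divide del: complex_cnj_diff)
  have "\<rho> \<noteq> 0"
  proof
    assume "\<rho> = 0"
    then have "cnj (1 + \<zeta>) = 0" by (simp add: \<rho>_def)
    then show False using \<zeta>1 by (simp only: complex_cnj_zero_iff)
  qed
  have "c < 1"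
  proof -
    \<comment> \<open>The parallelogram law for 1 and \<open>\<zeta>\<close>; the nonzero second
      diagonal makes the bound on the first strict.\<close>
    have "(cmod (1 - \<zeta>))\<^sup>2 + (cmod (1 + \<zeta>))\<^sup>2 = 2 + 2 * (cmod \<zeta>)\<^sup>2" (is "?l + ?r = _")
      unfolding cmod_power2 by (simp add: power2_eq_square algebra_simps)
    moreover have "(cmod (1 + \<zeta>))\<^sup>2 > 0" using \<zeta>1 by simp
    ultimately have "?l < 4" unfolding \<zeta>(2) power_one by linarith
    then have "?l < 2\<^sup>2" by simp
    then have "cmod (1 - \<zeta>) < 2" by (rule power2_less_imp_less) simp
    then show ?thesis by (simp add: c_def)
  qed
  define M where "M = {(s *\<^sub>R x, app x) | x. x \<in> dom A}"
  have "csubspace M"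
    unfolding csubspace_def
  proof (intro conjI ballI allI)
    show "0 \<in> M" unfolding M_def using zero_in_dom app_zero by (force simp: zero_prod_def)
  next
    fix m m' assume "m \<in> M" "m' \<in> M"
    then obtain x x' where x: "m = (s *\<^sub>R x, app x)" "x \<in> dom A"
      and x': "m' = (s *\<^sub>R x', app x')" "x' \<in> dom A"
      unfolding M_def by auto
    then have "m + m' = (s *\<^sub>R (x + x'), app (x + x'))"
      by (simp add: app_add[OF x(2) x'(2)] scaleR_add_right)
    with dom_add[OF x(2) x'(2)] show "m + m' \<in> M" unfolding M_def by blast
  next
    fix k m assume "m \<in> M"
    then obtain x where x: "m = (s *\<^sub>R x, app x)" "x \<in> dom A" unfolding M_def by auto
    then have "k *\<^sub>C m = (s *\<^sub>R (k *\<^sub>C x), app (k *\<^sub>C x))"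
      by (simp add: scaleC_prod_def app_scaleC scaleR_scaleC scaleC_scaleC mult.commute)
    with x dom_scaleC show "k *\<^sub>C m \<in> M" unfolding M_def by blast
  qed
  moreover have "complete M"
  proof -
    \<comment> \<open>Undoing the rescaling exhibits \<open>M\<close> as a continuous preimage of
      the closed graph of \<open>A\<close>.\<close>
    have "M = (\<lambda>m. (inverse s *\<^sub>R fst m, snd m)) -` Map.graph A"
    proof (intro set_eqI iffI)
      fix m assume "m \<in> M"
      then show "m \<in> (\<lambda>m. (inverse s *\<^sub>R fst m, snd m)) -` Map.graph A"
        using s(1) by (auto simp: M_def Map.graph_def)
    next
      fix m assume "m \<in> (\<lambda>m. (inverse s *\<^sub>R fst m, snd m)) -` Map.graph A"
      then have "A (inverse s *\<^sub>R fst m) = Some (snd m)"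
        by (simp add: Map.graph_def)
      then have "inverse s *\<^sub>R fst m \<in> dom A"
        and "m = (s *\<^sub>R (inverse s *\<^sub>R fst m), app (inverse s *\<^sub>R fst m))"
        using s(1) by (auto simp: prod_eq_iff)
      then show "m \<in> M" unfolding M_def by blast
    qed
    moreover have "closed ((\<lambda>m. (inverse s *\<^sub>R fst m, snd m)) -` Map.graph A)"
      using closed unfolding closed_op_def by (intro closed_vimage continuous_intros)
    ultimately show ?thesis by (simp add: complete_eq_closed)
  qed
  \<comment> \<open>On \<open>M\<close> the form \<open>cinner (D m) m'\<close> is the left side of
    the weak equation, because \<open>s * s\<close> times \<open>\<zeta>\<close> is
    \<open>z\<close>. The datum \<open>(inverse s *\<^sub>R p, q)\<close> used below undoes the
    scaling on the right side.\<close>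
  moreover define D :: "'a \<times> 'a \<Rightarrow> 'a \<times> 'a" where "D m = (\<zeta> *\<^sub>C fst m, snd m)" for m
  have "D (x - y) = D x - D y" for x y
    by (simp add: D_def scaleC_diff_right)
  moreover have "norm (m - \<rho> *\<^sub>C D m) \<le> c * norm m" for m
  proof -
    have "m - \<rho> *\<^sub>C D m = ((1 - \<rho> * \<zeta>) *\<^sub>C fst m, (1 - \<rho>) *\<^sub>C snd m)"
      by (simp add: D_def scaleC_prod_def prod_eq_iff scaleC_diff_left scaleC_scaleC)
    then have "norm (m - \<rho> *\<^sub>C D m) = sqrt (c\<^sup>2 * ((norm (fst m))\<^sup>2 + (norm (snd m))\<^sup>2))"
      by (simp add: norm_Pair norm_scaleC mod power_mult_distrib distrib_left)
    also have "\<dots> = c * norm m"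
      by (simp add: real_sqrt_mult norm_prod_def c_def)
    finally show ?thesis by simp
  qed
  ultimately obtain m where m: "m \<in> M"
    "\<And>x. x \<in> M \<Longrightarrow> cinner (D m - (inverse s *\<^sub>R p, q)) x = 0"
    using lax_milgram[of M D c \<rho> "(inverse s *\<^sub>R p, q)"] \<open>c < 1\<close> \<open>\<rho> \<noteq> 0\<close> by blast
  then obtain u where u: "u \<in> dom A" "m = (s *\<^sub>R u, app u)"
    unfolding M_def by auto
  have "z * cinner u x + cinner (app u) (app x) = cinner p x + cinner q (app x)"
    if x: "x \<in> dom A" for x
  proof -
    have "cinner (D m - (inverse s *\<^sub>R p, q)) (s *\<^sub>R x, app x) = 0"
      using x by (intro m(2)) (auto simp: M_def)
    moreover have "cinner (\<zeta> *\<^sub>C (s *\<^sub>R u)) (s *\<^sub>R x) = z * cinner u x"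
      unfolding \<zeta>(1)[symmetric] by (simp add: cinner_simps cinner_scaleR_left cinner_scaleR_right)
    moreover have "cinner (inverse s *\<^sub>R p) (s *\<^sub>R x) = cinner p x"
      using s(1) by (simp add: cinner_scaleR_left cinner_scaleR_right)
    ultimately show ?thesis
      by (simp add: u(2) D_def cinner_prod_def cinner_diff_left) algebra
  qed
  with u(1) show ?thesis unfolding weak_solution_def by blast
qed

text \<open>The number |z| + z bisects the angle between \<open>z\<close> and the positive axis.
  Multiplying the equation tested with \<open>u\<close> by its conjugate and taking real parts gives
  both quadratic terms a positive weight.\<close>

lemma norm_weak_solution_le:
  assumes z: "complex_of_real (cmod z) + z \<noteq> 0" and u: "weak_solution z 0 f u"
  shows "norm u \<le> sqrt (cmod z) / cmod (of_real (cmod z) + z) * norm f"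
proof -
  define t where "t = cmod z"
  define h where "h = cmod (of_real t + z)"
  define g where "g = t + Re z"
  define X where "X = (norm u)\<^sup>2"
  define y where "y = norm (app u)"
  have h: "h > 0" using z by (simp add: h_def t_def)
  have t: "t > 0" using z unfolding t_def by auto
  have t2: "t\<^sup>2 = (Re z)\<^sup>2 + (Im z)\<^sup>2" by (simp add: t_def cmod_power2)
  have h2: "h\<^sup>2 = 2 * t * g"
    unfolding h_def cmod_power2 using t2 by (simp add: g_def power2_eq_square algebra_simps)
  have "z * of_real X + of_real (y\<^sup>2) = cinner f (app u)"
    using u unfolding weak_solution_def X_def y_def cinner_self[symmetric] by auto
  then have "Re (cnj (of_real t + z) * cinner f (app u))
      = Re (cnj (of_real t + z) * (z * of_real X + of_real (y\<^sup>2)))"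
    by simp
  also have "\<dots> = g * (t * X + y\<^sup>2)"
    using t2 unfolding g_def by (simp add: power2_eq_square) algebra
  finally have "g * (t * X + y\<^sup>2) \<le> cmod (cnj (of_real t + z) * cinner f (app u))"
    using complex_Re_le_cmod[of "cnj (of_real t + z) * cinner f (app u)"] by simp
  also have "\<dots> = h * cmod (cinner f (app u))"
    unfolding norm_mult complex_mod_cnj h_def ..
  also have "\<dots> \<le> h * (norm f * y)"
    unfolding y_def using h by (intro mult_left_mono norm_cinner_le) auto
  finally have "2 * t * (g * (t * X + y\<^sup>2)) \<le> 2 * t * (h * (norm f * y))"
    using t by (intro mult_left_mono) auto
  then have "h * (h * (t * X + y\<^sup>2)) \<le> h * (2 * t * (norm f * y))"
    using arg_cong[OF h2, of "\<lambda>r. r * (t * X + y\<^sup>2)"]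
    by (simp only: power2_eq_square[of h] mult_ac)
  then have "h * (t * X + y\<^sup>2) \<le> 2 * t * (norm f * y)"
    using h by simp
  then have "h * (h * (t * X + y\<^sup>2)) \<le> 2 * (t * norm f) * (h * y)"
    using h mult_left_mono[of "h * (t * X + y\<^sup>2)" "2 * t * (norm f * y)" h] by (simp add: mult_ac)
  \<comment> \<open>The completed square: the term \<open>(h * y)\<^sup>2\<close> cancels against
    the left side above, which leaves a bound on \<open>u\<close> alone.\<close>
  moreover have "2 * (t * norm f) * (h * y) \<le> (t * norm f)\<^sup>2 + (h * y)\<^sup>2"
    using sum_squares_bound[of "t * norm f" "h * y"] by simp
  ultimately have "t * (h\<^sup>2 * X) \<le> t * (t * (norm f)\<^sup>2)"
    by (simp add: power2_eq_square algebra_simps)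
  then have "h\<^sup>2 * X \<le> t * (norm f)\<^sup>2" using t by simp
  then have "(h * norm u)\<^sup>2 \<le> (sqrt t * norm f)\<^sup>2"
    using t by (simp add: power_mult_distrib X_def)
  then have "h * norm u \<le> sqrt t * norm f"
    by (rule power2_le_imp_le) (simp add: less_imp_le[OF t])
  then show ?thesis
    using h unfolding h_def t_def by (simp add: field_simps)
qed

lemma weak_solution_unique:
  assumes "complex_of_real (cmod z) + z \<noteq> 0" "weak_solution z p q u" "weak_solution z p q u'"
  shows "u = u'"
  using norm_weak_solution_le[OF assms(1), of 0 "u - u'"] weak_solution_diff[OF assms(2,3)] by simp

section \<open>Density of the adjoint's domain, and the closure of the composed operator\<close>

text \<open>For \<open>y\<close> orthogonal to the domain, the weak solution with
  \<open>z = 1\<close>, \<open>q = y\<close> splits \<open>y = v + app u\<close> where the adjoint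
  sends \<open>v\<close> to \<open>u\<close>. Pairing \<open>y\<close> with \<open>v\<close> gives
  |v|^2 + |u|^2 = 0, so \<open>y = 0\<close>.\<close>

lemma dense_dom_adjoint: "closure (dom (op_adjoint A)) = UNIV"
proof (rule dense_of_trivial_orthogonal[OF csubspace_dom_adjoint])
  fix y assume orth: "\<And>x. x \<in> dom (op_adjoint A) \<Longrightarrow> cinner y x = 0"
  obtain u where "weak_solution 1 0 y u"
    using weak_solution_exists[of 1 0 y] by auto
  then have u: "u \<in> dom A" and v: "op_adjoint A (y - app u) = Some u"
    by (simp_all add: weak_solution_iff_adjoint)
  define v where "v = y - app u"
  have "cinner v (app u) = cinner u u"
    using u v unfolding v_def adjoint_eq_Some by blast
  moreover have "cinner y v = 0" using v by (intro orth) (simp add: v_def domIff)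
  then have "cinner v y = 0" by (metis cinner_commute complex_cnj_zero)
  moreover have "cinner v y = cinner v v + cinner v (app u)"
    unfolding cinner_add_right[symmetric] by (simp add: v_def)
  ultimately have "complex_of_real ((norm v)\<^sup>2 + (norm u)\<^sup>2) = 0"
    by (simp add: cinner_self)
  then have "(norm v)\<^sup>2 + (norm u)\<^sup>2 = 0" by (simp only: of_real_eq_0_iff)
  then have "v = 0" "u = 0" by simp_all
  then show "y = 0" by (simp add: v_def)
qed

text \<open>With \<open>q = 0\<close> the weak equation is the strong one, up to the sign handled by
  \<open>neg\<close>. Uniqueness of weak solutions is injectivity of the shifted operator, so its
  inverse relation is single valued.\<close>

lemma op_inverse_shift_eq_Some:
  assumes "complex_of_real (cmod z) + z \<noteq> 0"
  shows "op_inverse (op_plus_scalar (op_adjoint A \<circ>\<^sub>m A) z) w = Some u \<longleftrightarrow> weak_solution z w 0 u"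
proof -
  let ?T = "op_plus_scalar (op_adjoint A \<circ>\<^sub>m A) z"
  have neg: "op_adjoint A (- v) = Some (- w) \<longleftrightarrow> op_adjoint A v = Some w" for v w
    by (simp add: adjoint_eq_Some cinner_minus_left)
  have T: "?T u = Some w \<longleftrightarrow> weak_solution z w 0 u" for u w
    using neg[of "app u" "w - z *\<^sub>C u"]
    by (cases "A u")
      (auto simp: weak_solution_iff_adjoint op_plus_scalar_def map_comp_def)
  have "single_valued ((Map.graph ?T)\<inverse>)"
    using weak_solution_unique[OF assms] by (auto simp: single_valued_def Map.graph_def T)
  then show ?thesis
    unfolding op_inverse_def by (simp add: op_of_graph_eq_Some) (simp add: Map.graph_def T)
qed

lemma closure_inverse_shift_adjoint:
  fixes z :: complex
  assumes z: "complex_of_real (cmod z) + z \<noteq> 0"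
  defines "S\<^sub>0 \<equiv> op_inverse (op_plus_scalar (op_adjoint A \<circ>\<^sub>m A) z) \<circ>\<^sub>m op_adjoint A"
  shows "dom S\<^sub>0 = dom (op_adjoint A)" "closable_op S\<^sub>0" "bounded_op (op_closure S\<^sub>0)"
    "dom (op_closure S\<^sub>0) = UNIV"
    "onorm (\<lambda>x. the (op_closure S\<^sub>0 x)) \<le> sqrt (cmod z) / cmod (of_real (cmod z) + z)"
proof -
  define K where "K = sqrt (cmod z) / cmod (of_real (cmod z) + z)"
  obtain Q where Q: "\<And>f. weak_solution z 0 f (Q f)"
    using weak_solution_exists[OF z] by metis
  note uniq = weak_solution_unique[OF z]
  have Q_add: "Q (f + g) = Q f + Q g" for f g
    using weak_solution_add[OF Q Q, of f g] by (intro uniq[OF Q]) simp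
  have Q_scaleC: "Q (c *\<^sub>C f) = c *\<^sub>C Q f" for c f
    using weak_solution_scaleC[OF Q, of c f] by (intro uniq[OF Q]) simp
  have Q_norm: "norm (Q f) \<le> K * norm f" for f
    unfolding K_def by (rule norm_weak_solution_le[OF z Q])
  have "continuous_on UNIV Q"
    by (intro linear_continuous_on bounded_linear_intro[of _ K])
      (simp_all add: Q_add Q_scaleC scaleR_scaleC Q_norm mult.commute)
  moreover have S\<^sub>0: "S\<^sub>0 = (\<lambda>v. if v \<in> dom (op_adjoint A) then Some (Q v) else None)"
  proof
    fix v
    show "S\<^sub>0 v = (if v \<in> dom (op_adjoint A) then Some (Q v) else None)"
    proof (cases "op_adjoint A v")
      case (Some w)
      have u: "Q v \<in> dom A" "op_adjoint A (v - app (Q v)) = Some (z *\<^sub>C Q v)"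
        using Q[of v] by (auto simp: weak_solution_iff_adjoint)
      \<comment> \<open>Since \<open>v\<close> itself lies in the domain of the adjoint, it can be
        subtracted off: the datum \<open>v\<close> in the slot \<open>q\<close> becomes the datum
        \<open>w\<close> in the slot \<open>p\<close>, which is the resolvent equation.\<close>
      have "op_adjoint A (v - app (Q v) - v) = Some (z *\<^sub>C Q v - w)"
        by (rule adjoint_diff[OF u(2) Some])
      then have "weak_solution z w 0 (Q v)"
        using u(1) by (simp add: weak_solution_iff_adjoint)
      with Some show ?thesis
        unfolding S\<^sub>0_def by (simp add: op_inverse_shift_eq_Some[OF z] domIff)
    qed (simp add: S\<^sub>0_def domIff)
  qed
  ultimately have cl: "closure (Map.graph S\<^sub>0) = {(x, Q x) | x. True}"
    using closure_graph_restrict[OF _ dense_dom_adjoint] by simp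
  show "dom S\<^sub>0 = dom (op_adjoint A)"
    unfolding S\<^sub>0 by (auto split: if_splits)
  show closable: "closable_op S\<^sub>0"
    unfolding closable_op_def cl by (auto simp: single_valued_def)
  have S: "op_closure S\<^sub>0 = (\<lambda>x. Some (Q x))"
    using op_of_graph_eq_Some[OF closable[unfolded closable_op_def]]
    unfolding op_closure_def cl by auto
  show "dom (op_closure S\<^sub>0) = UNIV"
    unfolding S by auto
  show "bounded_op (op_closure S\<^sub>0)"
    unfolding S bounded_op_def linear_op_def using Q_norm by (auto simp: Q_add Q_scaleC)
  show "onorm (\<lambda>x. the (op_closure S\<^sub>0 x)) \<le> sqrt (cmod z) / cmod (of_real (cmod z) + z)"
    unfolding S K_def[symmetric] option.sel by (rule onorm_bound[OF _ Q_norm]) (simp add: K_def)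
qed

end

theorem theorem2:
  fixes A :: "'a::chilbert_space \<rightharpoonup> 'a" and a :: real
  assumes "linear_op A" and "closed_op A" and "densely_defined A" and "a > 0"
  shows "let T = op_adjoint A \<circ>\<^sub>m A;
             T\<^sub>a = op_plus_scalar T (complex_of_real a);
             T\<^sub>i\<^sub>a = op_plus_scalar T (\<i> * complex_of_real a);
             S\<^sub>0 = op_inverse T\<^sub>a \<circ>\<^sub>m op_adjoint A;
             S = op_closure S\<^sub>0;
             R\<^sub>0 = op_inverse T\<^sub>i\<^sub>a \<circ>\<^sub>m op_adjoint A;
             R = op_closure R\<^sub>0
         in (dom S\<^sub>0 = dom (op_adjoint A) \<and> closable_op S\<^sub>0 \<and>
             bounded_op S \<and> dom S = UNIV \<and> onorm (\<lambda>x. the (S x)) \<le> 1 / (2 * sqrt a)) \<and>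
            (dom R\<^sub>0 = dom (op_adjoint A) \<and> closable_op R\<^sub>0 \<and>
             bounded_op R \<and> dom R = UNIV)"
proof -
  interpret closed_dense_op A
    using assms by unfold_locales
  have a: "complex_of_real (cmod (complex_of_real a)) + complex_of_real a \<noteq> 0"
    "complex_of_real (cmod (\<i> * complex_of_real a)) + \<i> * complex_of_real a \<noteq> 0"
    using assms(4) by (auto simp: complex_eq_iff)
  \<comment> \<open>At \<open>z = a\<close> the general constant is
    \<open>sqrt a / (2 * a)\<close>.\<close>
  have "cmod (complex_of_real (cmod (complex_of_real a)) + complex_of_real a) = 2 * a"
    using assms(4) by (simp add: of_real_add[symmetric] del: of_real_add)
  moreover have "sqrt a / (2 * a) = 1 / (2 * sqrt a)"
    using assms(4) real_div_sqrt[of a] by (simp add: field_simps)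
  ultimately have "sqrt (cmod (complex_of_real a))
      / cmod (complex_of_real (cmod (complex_of_real a)) + complex_of_real a) = 1 / (2 * sqrt a)"
    using assms(4) by simp
  with closure_inverse_shift_adjoint[OF a(1)] closure_inverse_shift_adjoint[OF a(2)]
  show ?thesis
    unfolding Let_def by simp
qed

end
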